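(* Let $d\ge 2$ and let $D$ be a $d$-ary tree with at least two leaves, with branches $D_1,D_2,\ldots,D_d$ (some of which may be empty). Then $$I_d(D)\ge\binom{\|D\|}{\|D_1\|,\|D_2\|,\ldots,\|D_d\|}\,\|D\|^{-\|D\|}\,\prod_{i=1}^d\|D_i\|^{\|D_i\|}\,\prod_{i=1}^d I_d(D_i).$$
   Context: A $d$-ary tree is a finite rooted tree in which every internal (non-leaf) vertex has at least two and at most $d$ children; a single vertex is a $d$-ary tree with one leaf, and the empty tree with $0$ leaves is also allowed. Isomorphism means root-preserving isomorphism. $\|T\|$ denotes the number of leaves of $T$. A set $S$ of leaves of $T$ induces a $d$-ary tree: take the smallest subtree of $T$ containing all leaves in $S$ (rooted at the most recent common ancestor of $S$) and repeatedly suppress every vertex with exactly one child (contracting its two adjacent edges to a single edge). $c(D,T)$ is the number of sets of $\|D\|$ leaves of $T$ that induce a tree isomorphic to $D$, and $\gamma(D,T)=c(D,T)/\binom{\|T\|}{\|D\|}$. The $d$-ary inducibility of a nonempty $d$-ary tree $D$ is $$I_d(D)=\limsup_{n\to\infty}\ \max_{\substack{\|T\|=n\\ T\ d\text{-ary tree}}}\gamma(D,T),$$ and $I_d(D)=1$ if $D$ is empty. The branches of a $d$-ary tree $D$ with at least two leaves are the components (rooted at the children of the root) obtained on removing the root; the list is padded with empty trees to have exactly $d$ entries $D_1,\ldots,D_d$. The convention $0^0=1$ is used. *)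

theory Defs
  imports "HOL-Analysis.Analysis" "HOL-Library.Sublist"
begin

text \<open>
  Nonempty finite rooted trees. The children form a list only in order to address vertices;
  the order is forgotten by \<open>tree_iso\<close>.
\<close>

datatype rtree = Node (children: "rtree list")

lemma size_nth_child [termination_simp]:
  "i < length ts \<Longrightarrow> size (ts ! i) < Suc (size_list size (ts :: rtree list))"
  by (metis less_Suc_eq_le nth_mem order_refl size_list_estimation')

text \<open>\<open>None\<close> is the empty tree.\<close>

type_synonym tree = "rtree option"

text \<open>A vertex is the list of child indices on the path leading to it from the root \<open>[]\<close>.\<close>

fun vertices :: "rtree \<Rightarrow> nat list set" where
  "vertices (Node ts) = insert [] (\<Union>i\<in>{..<length ts}. (#) i ` vertices (ts ! i))"

definition edges :: "rtree \<Rightarrow> nat list set set" where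
  "edges t = {{p, p @ [i]} | p i. p @ [i] \<in> vertices t}"

definition rtree_leaves :: "rtree \<Rightarrow> nat list set" where
  "rtree_leaves t = {p \<in> vertices t. \<forall>i. p @ [i] \<notin> vertices t}"

definition leaves :: "tree \<Rightarrow> nat list set" where
  "leaves T = (case T of None \<Rightarrow> {} | Some t \<Rightarrow> rtree_leaves t)"

definition num_leaves :: "tree \<Rightarrow> nat" where
  "num_leaves T = card (leaves T)"

definition rtree_iso :: "rtree \<Rightarrow> rtree \<Rightarrow> bool" where
  "rtree_iso t u \<longleftrightarrow>
    (\<exists>f. bij_betw f (vertices t) (vertices u) \<and> f [] = [] \<and>
      (\<forall>p\<in>vertices t. \<forall>q\<in>vertices t. {p, q} \<in> edges t \<longleftrightarrow> {f p, f q} \<in> edges u))"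

definition tree_iso :: "tree \<Rightarrow> tree \<Rightarrow> bool" where
  "tree_iso = rel_option rtree_iso"

fun rtree_dary :: "nat \<Rightarrow> rtree \<Rightarrow> bool" where
  "rtree_dary d (Node ts) \<longleftrightarrow>
    (ts = [] \<or> 2 \<le> length ts \<and> length ts \<le> d) \<and> (\<forall>t\<in>set ts. rtree_dary d t)"

definition dary :: "nat \<Rightarrow> tree \<Rightarrow> bool" where
  "dary d T \<longleftrightarrow> (\<forall>t. T = Some t \<longrightarrow> rtree_dary d t)"

fun subtree_at :: "rtree \<Rightarrow> nat list \<Rightarrow> rtree" where
  "subtree_at t [] = t"
| "subtree_at t (i # p) = subtree_at (children t ! i) p"

text \<open>
  For a nonempty set \<open>S\<close> of leaves of \<open>t\<close>, \<open>prune t S\<close> is the union of the paths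
  from the root of \<open>t\<close> to the leaves in \<open>S\<close>.
\<close>

fun prune :: "rtree \<Rightarrow> nat list set \<Rightarrow> rtree" where
  "prune (Node ts) S =
    Node (map (\<lambda>i. prune (ts ! i) {p. i # p \<in> S})
      (filter (\<lambda>i. \<exists>p. i # p \<in> S) [0..<length ts]))"

fun suppress :: "rtree \<Rightarrow> rtree" where
  "suppress (Node ts) = (case map suppress ts of [u] \<Rightarrow> u | us \<Rightarrow> Node us)"

text \<open>
  The most recent common ancestor of \<open>S\<close> is the longest common prefix of its elements.
  The smallest subtree containing \<open>S\<close> consists of the paths from there down to \<open>S\<close>.
\<close>

definition spanned :: "rtree \<Rightarrow> nat list set \<Rightarrow> rtree" where
  "spanned t S =
    (let r = Longest_common_prefix S in prune (subtree_at t r) {p. r @ p \<in> S})"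

definition induced :: "tree \<Rightarrow> nat list set \<Rightarrow> tree" where
  "induced T S =
    (if S = {} then None else map_option (\<lambda>t. suppress (spanned t S)) T)"

definition copies :: "tree \<Rightarrow> tree \<Rightarrow> nat" where
  "copies D T =
    card {S. S \<subseteq> leaves T \<and> card S = num_leaves D \<and> tree_iso (induced T S) D}"

definition copy_density :: "tree \<Rightarrow> tree \<Rightarrow> real" where
  "copy_density D T = real (copies D T) / real (num_leaves T choose num_leaves D)"

definition max_density :: "nat \<Rightarrow> tree \<Rightarrow> nat \<Rightarrow> real" where
  "max_density d D n = Max {copy_density D T | T. dary d T \<and> num_leaves T = n}"

text \<open>
  The densities with \<open>n\<close> leaves are finitely many numbers in \<open>[0, 1]\<close>, and they exist
  for every \<open>n\<close> if \<open>d \<ge> 2\<close>; so the maximum is attained and the upper limit is finite.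
\<close>

definition inducibility :: "nat \<Rightarrow> tree \<Rightarrow> real" where
  "inducibility d D =
    (if D = None then 1
     else real_of_ereal (limsup (\<lambda>n. ereal (max_density d D n))))"

definition branches :: "nat \<Rightarrow> tree \<Rightarrow> tree list" where
  "branches d D =
    (case D of
      None \<Rightarrow> replicate d None
    | Some t \<Rightarrow> map Some (children t) @ replicate (d - length (children t)) None)"

definition multinomial :: "nat \<Rightarrow> nat list \<Rightarrow> real" where
  "multinomial n ks = fact n / (\<Prod>k\<leftarrow>ks. fact k)"

end

theory Submission
  imports Defs
begin

text \<open>
  Deleting a random leaf of a tree preserves the density of \<open>D\<close> on average. Hence the maximal
  density is nonincreasing in the number \<open>n \<ge> \<parallel>D\<parallel>\<close> of leaves, so it converges to \<open>I\<^sub>d(D)\<close> and is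
  bounded below by it. For every \<open>m \<ge> 1\<close> one can therefore choose trees \<open>T\<^sub>i\<close> with \<open>m\<parallel>D\<^sub>i\<parallel>\<close> leaves
  in which \<open>D\<^sub>i\<close> has density at least \<open>I\<^sub>d(D\<^sub>i)\<close>. In the tree with branches \<open>T\<^sub>i\<close>, picking one copy of
  each \<open>D\<^sub>i\<close> in \<open>T\<^sub>i\<close> gives a copy of \<open>D\<close>, and the bound follows as \<open>m \<rightarrow> \<infinity>\<close>.
\<close>

section \<open>Vertices and leaves by recursion over the tree\<close>

lemma Nil_mem_vertices: "[] \<in> vertices t"
  by (cases t) simp

lemma Cons_mem_vertices_iff:
  "i # p \<in> vertices (Node ts) \<longleftrightarrow> i < length ts \<and> p \<in> vertices (ts ! i)"
  by auto

lemma Cons_mem_rtree_leaves_iff: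
  "i # p \<in> rtree_leaves (Node ts) \<longleftrightarrow> i < length ts \<and> p \<in> rtree_leaves (ts ! i)"
  by (simp add: rtree_leaves_def Cons_mem_vertices_iff del: vertices.simps) blast

lemma Nil_mem_rtree_leaves_iff: "[] \<in> rtree_leaves (Node ts) \<longleftrightarrow> ts = []"
proof -
  have "[i] \<in> vertices (Node ts) \<longleftrightarrow> i < length ts" for i
    by (simp add: Cons_mem_vertices_iff Nil_mem_vertices del: vertices.simps)
  then show ?thesis
    by (simp add: rtree_leaves_def Nil_mem_vertices del: vertices.simps) fastforce
qed

lemma rtree_leaves_Node:
  "rtree_leaves (Node ts) =
    (if ts = [] then {[]} else (\<Union>i<length ts. (#) i ` rtree_leaves (ts ! i)))"
proof (rule set_eqI)
  fix p
  show "p \<in> rtree_leaves (Node ts) \<longleftrightarrow>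
     p \<in> (if ts = [] then {[]} else (\<Union>i<length ts. (#) i ` rtree_leaves (ts ! i)))"
    by (cases p) (auto simp: Nil_mem_rtree_leaves_iff Cons_mem_rtree_leaves_iff)
qed

lemma finite_rtree_leaves: "finite (rtree_leaves t)"
  by (induction t) (auto simp: rtree_leaves_Node)

lemma rtree_leaves_nonempty: "rtree_leaves t \<noteq> {}"
proof (induction t)
  case (Node ts)
  have "rtree_leaves (ts ! 0) \<noteq> {}" if "ts \<noteq> []"
    using that by (intro Node.IH) simp
  then show ?case by (auto simp: rtree_leaves_Node)
qed

section \<open>Restriction of a tree to a set of its leaves\<close>

text \<open>
  The path from the root to the most recent common ancestor of \<open>S\<close> need not be cut off, since
  \<open>suppress\<close> contracts it; this makes the induced tree accessible to structural recursion.
\<close>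

definition restrict_tree :: "rtree \<Rightarrow> nat list set \<Rightarrow> rtree" where
  "restrict_tree t S = suppress (prune t S)"

text \<open>This is the filter occurring in \<open>prune\<close>, so unfolding \<open>prune\<close>
  produces it literally.\<close>

abbreviation hit :: "rtree list \<Rightarrow> nat list set \<Rightarrow> nat list" where
  "hit ts S \<equiv> filter (\<lambda>i. \<exists>p. i # p \<in> S) [0..<length ts]"

lemma restrict_Node:
  "restrict_tree (Node ts) S =
    (case map (\<lambda>i. restrict_tree (ts ! i) {p. i # p \<in> S}) (hit ts S) of [u] \<Rightarrow> u | us \<Rightarrow> Node us)"
  by (simp add: restrict_tree_def comp_def)

lemma restrict_Node_single:
  assumes "hit ts S = [i]"
  shows "restrict_tree (Node ts) S = restrict_tree (ts ! i) {p. i # p \<in> S}"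
  by (simp add: restrict_Node assms)

lemma restrict_Node_multi:
  assumes "length (hit ts S) \<noteq> 1"
  shows "restrict_tree (Node ts) S = Node (map (\<lambda>i. restrict_tree (ts ! i) {p. i # p \<in> S}) (hit ts S))"
  using assms by (auto simp: restrict_Node split: list.split)

lemma filter_upt_eq_single:
  assumes "i < n" "\<And>j. P j \<longleftrightarrow> j = i"
  shows "filter P [0..<n] = [i]"
proof -
  have "filter (\<lambda>j. j = i) [0..<n] = [i]"
    using assms(1) by (induction n) (auto simp: less_Suc_eq filter_empty_conv)
  then show ?thesis using assms(2) by presburger
qed

text \<open>At every proper prefix of \<open>r\<close> exactly one child leads to \<open>S\<close>,
  so \<open>suppress\<close> passes straight through that vertex. With \<open>r\<close> the longest
  common prefix this removes the most recent common ancestor from the definition of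
  \<open>induced\<close>.\<close>

lemma restrict_subtree_at:
  assumes "S \<noteq> {}" "S \<subseteq> vertices t" "\<And>p. p \<in> S \<Longrightarrow> prefix r p"
  shows "restrict_tree (subtree_at t r) {p. r @ p \<in> S} = restrict_tree t S"
  using assms
proof (induction r arbitrary: t S)
  case (Cons i r)
  obtain ts where t: "t = Node ts" by (cases t)
  let ?S = "{p. i # p \<in> S}"
  have pre: "\<exists>q. p = i # q \<and> prefix r q" if "p \<in> S" for p
    using Cons.prems(3)[OF that] by (auto simp: prefix_def)
  have S: "S = (#) i ` ?S" using pre by (auto simp: image_iff)
  have ne: "?S \<noteq> {}" using S Cons.prems(1) by auto
  then have i: "i < length ts" using Cons.prems(2) by (auto simp: t)
  have hit: "hit ts S = [i]"
    by (rule filter_upt_eq_single[OF i]) (use pre ne in auto)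
  have "restrict_tree (subtree_at (ts ! i) r) {p. r @ p \<in> ?S} = restrict_tree (ts ! i) ?S"
    by (rule Cons.IH) (use ne Cons.prems pre t in auto)
  then show ?case by (simp add: t restrict_Node_single[OF hit])
qed simp

lemma induced_Some:
  assumes "S \<noteq> {}" "S \<subseteq> rtree_leaves t"
  shows "induced (Some t) S = Some (restrict_tree t S)"
proof -
  have "restrict_tree (subtree_at t (Longest_common_prefix S)) {p. Longest_common_prefix S @ p \<in> S}
      = restrict_tree t S"
    using assms by (intro restrict_subtree_at)
      (auto simp: rtree_leaves_def intro: Longest_common_prefix_prefix)
  then show ?thesis using assms by (simp add: induced_def spanned_def restrict_tree_def Let_def)
qed

text \<open>As \<open>ts\<close> is nonempty, the root is not a leaf, so every element of
  \<open>U\<close> starts with the index of a child. These facts feed the inductions over trees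
  below.\<close>

lemma rtree_leaves_hit:
  assumes "U \<noteq> {}" "U \<subseteq> rtree_leaves (Node ts)" "ts \<noteq> []"
  shows "U = (\<Union>i\<in>set (hit ts U). (#) i ` {p. i # p \<in> U})" "hit ts U \<noteq> []"
    "\<And>i. {p. i # p \<in> U} \<subseteq> rtree_leaves (ts ! i)"
    "\<And>i. i \<in> set (hit ts U) \<Longrightarrow> {p. i # p \<in> U} \<noteq> {}"
proof -
  have *: "\<exists>i q. p = i # q \<and> i < length ts \<and> q \<in> rtree_leaves (ts ! i)" if "p \<in> U" for p
    using that assms by (auto simp: rtree_leaves_Node)
  show U: "U = (\<Union>i\<in>set (hit ts U). (#) i ` {p. i # p \<in> U})"
    using * by (fastforce simp: image_iff)
  show "hit ts U \<noteq> []" using U assms(1) by (metis UN_empty list.set(1))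
  show "{p. i # p \<in> U} \<subseteq> rtree_leaves (ts ! i)" for i using * by force
  show "{p. i # p \<in> U} \<noteq> {}" if "i \<in> set (hit ts U)" for i using that by auto
qed

text \<open>Restriction renumbers the surviving children consecutively. If \<open>Q\<close>
  describes the survivors, this turns a selection \<open>P\<close> of original indices into a
  selection of positions among the survivors.\<close>

lemma filter_filter_upt:
  assumes "\<And>i. P i \<Longrightarrow> Q i"
  shows "filter P [0..<n] =
    map ((!) (filter Q [0..<n])) (filter (\<lambda>j. P (filter Q [0..<n] ! j)) [0..<length (filter Q [0..<n])])"
    (is "_ = map ((!) ?I) _")
proof -
  have "filter P [0..<n] = filter P ?I"
    using assms by (auto intro: filter_cong)
  also have "\<dots> = filter P (map ((!) ?I) [0..<length ?I])" by (simp only: map_nth)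
  also have "\<dots> = map ((!) ?I) (filter (\<lambda>j. P (?I ! j)) [0..<length ?I])"
    by (simp only: filter_map comp_def)
  finally show ?thesis .
qed

text \<open>Restricting in two stages equals restricting once. Since addresses change when vertices
  disappear, \<open>g\<close> sends each leaf of the restricted tree to its original address. The
  order of children is kept, so the trees are equal and not merely isomorphic.\<close>

lemma restrict_restrict:
  assumes "U \<noteq> {}" "U \<subseteq> rtree_leaves t"
  shows "\<exists>g. bij_betw g (rtree_leaves (restrict_tree t U)) U \<and>
    (\<forall>S\<subseteq>rtree_leaves (restrict_tree t U). S \<noteq> {} \<longrightarrow> restrict_tree t (g ` S) = restrict_tree (restrict_tree t U) S)"
  using assms
proof (induction t arbitrary: U)
  case (Node ts)
  show ?case
  proof (cases "ts = []")
    case True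
    then have "U = {[]}" using Node.prems by (auto simp: rtree_leaves_Node)
    then show ?thesis
      by (intro exI[of _ id]) (simp add: True restrict_tree_def rtree_leaves_Node)
  next
    case False
    define I where "I = hit ts U"
    define V where "V = (\<lambda>i. {p. i # p \<in> U})"
    define R where "R = (\<lambda>i. restrict_tree (ts ! i) (V i))"
    note hit = rtree_leaves_hit[OF Node.prems False, folded I_def]
    have U: "U = (\<Union>i\<in>set I. (#) i ` V i)" using hit(1) by (simp only: V_def)
    have V: "V i \<subseteq> rtree_leaves (ts ! i)" for i unfolding V_def by (rule hit(3))
    have V0: "V i \<noteq> {}" and Its: "i < length ts" if "i \<in> set I" for i
      using that by (auto simp: I_def V_def)
    have "\<forall>i\<in>set I. \<exists>g. bij_betw g (rtree_leaves (R i)) (V i) \<and>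
      (\<forall>S\<subseteq>rtree_leaves (R i). S \<noteq> {} \<longrightarrow> restrict_tree (ts ! i) (g ` S) = restrict_tree (R i) S)"
      unfolding R_def by (intro ballI Node.IH V V0 nth_mem Its)
    from bchoice[OF this] obtain g where
      g: "\<And>i. i \<in> set I \<Longrightarrow> bij_betw (g i) (rtree_leaves (R i)) (V i)" and
      gR: "\<And>i S. i \<in> set I \<Longrightarrow> S \<subseteq> rtree_leaves (R i) \<Longrightarrow> S \<noteq> {} \<Longrightarrow>
        restrict_tree (ts ! i) (g i ` S) = restrict_tree (R i) S"
      by blast
    show ?thesis
    proof (cases "length I = 1")
      case True
      then obtain i where I: "I = [i]" by (auto simp: length_Suc_conv)
      then have i: "i \<in> set I" by simp
      have Ui: "U = (#) i ` V i" using U unfolding I by simp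
      have R: "restrict_tree (Node ts) U = R i"
        using restrict_Node_single[of U ts i] I by (simp only: I_def R_def V_def)
      \<comment> \<open>The root is suppressed in this case, so addresses in the restricted tree
        lack the index \<open>i\<close>; \<open>?g\<close> puts it back.\<close>
      let ?g = "\<lambda>p. i # g i p"
      have "bij_betw ((#) i \<circ> g i) (rtree_leaves (R i)) ((#) i ` V i)"
        using g[OF i] by (rule bij_betw_trans) (simp add: bij_betw_def)
      then have "bij_betw ?g (rtree_leaves (R i)) U"
        using Ui by (simp add: comp_def)
      moreover have "restrict_tree (Node ts) (?g ` S) = restrict_tree (R i) S"
        if S: "S \<subseteq> rtree_leaves (R i)" "S \<noteq> {}" for S
      proof -
        have h: "hit ts (?g ` S) = [i]"
          by (rule filter_upt_eq_single[OF Its[OF i]]) (use S in auto)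
        have "{p. i # p \<in> ?g ` S} = g i ` S" by auto
        then show ?thesis using gR[OF i S] by (simp add: restrict_Node_single[OF h])
      qed
      ultimately show ?thesis by (intro exI[of _ ?g]) (simp add: R)
    next
      case False
      let ?us = "map R I"
      have R: "restrict_tree (Node ts) U = Node ?us"
        using restrict_Node_multi[OF False[unfolded I_def]] by (simp only: I_def R_def V_def)
      have us: "?us \<noteq> []" using hit(2) by simp
      \<comment> \<open>Child \<open>j\<close> of the restricted tree comes from the original child
        \<open>I ! j\<close>. The value at \<open>[]\<close> is a dummy, as the root has children
        and is no leaf.\<close>
      let ?g = "\<lambda>p. case p of [] \<Rightarrow> [] | j # q \<Rightarrow> (I ! j) # g (I ! j) q"
      have Ij: "I ! j \<in> set I" if "j < length I" for j using that by (rule nth_mem)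
      have "distinct I" by (simp add: I_def)
      then have Iinj: "I ! j = I ! k \<longleftrightarrow> j = k" if "j < length I" "k < length I" for j k
        using that by (rule nth_eq_iff_index_eq)
      have lv: "rtree_leaves (Node ?us) = (\<Union>j<length I. (#) j ` rtree_leaves (R (I ! j)))"
        using us by (simp add: rtree_leaves_Node)
      have bij: "bij_betw ?g (rtree_leaves (Node ?us)) U"
      proof (rule bij_betw_imageI)
        show "inj_on ?g (rtree_leaves (Node ?us))"
        proof (rule inj_onI)
          fix p q assume p: "p \<in> rtree_leaves (Node ?us)" and q: "q \<in> rtree_leaves (Node ?us)"
            and e: "?g p = ?g q"
          obtain j p' where j: "j < length I" "p = j # p'" "p' \<in> rtree_leaves (R (I ! j))"
            using p unfolding lv by blast
          obtain k q' where k: "k < length I" "q = k # q'" "q' \<in> rtree_leaves (R (I ! k))"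
            using q unfolding lv by blast
          have e': "I ! j = I ! k \<and> g (I ! j) p' = g (I ! k) q'"
            using e unfolding j(2) k(2) list.case list.inject .
          then have "j = k" using Iinj[OF j(1) k(1)] by blast
          moreover have "p' = q'"
          proof (rule inj_onD[OF bij_betw_imp_inj_on[OF g[OF Ij[OF j(1)]]] _ j(3)])
            show "g (I ! j) p' = g (I ! j) q'" "q' \<in> rtree_leaves (R (I ! j))"
              using e' k(3) by metis+
          qed
          ultimately show "p = q" using j k by simp
        qed
        have "?g ` rtree_leaves (Node ?us)
          = (\<Union>j<length I. (#) (I ! j) ` (g (I ! j) ` rtree_leaves (R (I ! j))))"
          unfolding lv image_UN image_image by simp
        also have "\<dots> = (\<Union>j<length I. (#) (I ! j) ` V (I ! j))"
          using bij_betw_imp_surj_on[OF g[OF Ij]] by simp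
        also have "\<dots> = (\<Union>i\<in>(!) I ` {..<length I}. (#) i ` V i)"
          by simp
        also have "(!) I ` {..<length I} = set I"
          by (metis atLeast_upt list.set_map map_nth)
        finally show "?g ` rtree_leaves (Node ?us) = U" using U by simp
      qed
      moreover have "restrict_tree (Node ts) (?g ` S) = restrict_tree (Node ?us) S"
        if S: "S \<subseteq> rtree_leaves (Node ?us)" for S
      proof -
        have Sj: "\<exists>j q. p = j # q \<and> j < length I \<and> q \<in> rtree_leaves (R (I ! j))"
          if "p \<in> S" for p
          using that S unfolding lv by blast
        have gS: "{p. I ! j # p \<in> ?g ` S} = g (I ! j) ` {q. j # q \<in> S}"
          if j: "j < length I" for j
        proof (intro set_eqI iffI)
          fix p assume "p \<in> {p. I ! j # p \<in> ?g ` S}"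
          then obtain s where s: "s \<in> S" "I ! j # p = ?g s" by blast
          obtain k q where k: "s = k # q" "k < length I" using Sj[OF s(1)] by blast
          have "j = k" using Iinj[OF j k(2)] s(2) by (simp add: k(1))
          then show "p \<in> g (I ! j) ` {q. j # q \<in> S}" using s k by simp
        next
          fix p assume "p \<in> g (I ! j) ` {q. j # q \<in> S}"
          then obtain q where "j # q \<in> S" "p = g (I ! j) q" by blast
          then show "p \<in> {p. I ! j # p \<in> ?g ` S}" by (auto intro: rev_image_eqI)
        qed
        \<comment> \<open>The image lies in \<open>U\<close>, so it only meets children listed in
          \<open>I\<close>, and \<open>filter_filter_upt\<close> can translate indices.\<close>
        have "(\<exists>p. i # p \<in> ?g ` S) \<Longrightarrow> \<exists>p. i # p \<in> U" for i
          using bij_betw_imp_surj_on[OF bij] S by blast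
        then have "hit ts (?g ` S) = map ((!) I)
          (filter (\<lambda>j. \<exists>p. I ! j # p \<in> ?g ` S) [0..<length I])"
          unfolding I_def by (rule filter_filter_upt)
        also have "filter (\<lambda>j. \<exists>p. I ! j # p \<in> ?g ` S) [0..<length I] = hit ?us S"
        proof (rule filter_cong)
          fix j assume "j \<in> set [0..<length ?us]"
          then have "j < length I" by simp
          from gS[OF this] show "(\<exists>p. I ! j # p \<in> ?g ` S) = (\<exists>p. j # p \<in> S)"
            by blast
        qed simp
        finally have h: "hit ts (?g ` S) = map ((!) I) (hit ?us S)" .
        have "restrict_tree (ts ! (I ! j)) {p. I ! j # p \<in> ?g ` S}
            = restrict_tree (?us ! j) {p. j # p \<in> S}"
          if "j \<in> set (hit ?us S)" for j
        proof -
          have j: "j < length I" "{p. j # p \<in> S} \<noteq> {}" using that by auto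
          have "{p. j # p \<in> S} \<subseteq> rtree_leaves (R (I ! j))"
            using Sj by blast
          from gR[OF Ij[OF j(1)] this j(2)] show ?thesis
            using j(1) by (simp only: gS[OF j(1)] nth_map)
        qed
        then have "map (\<lambda>i. restrict_tree (ts ! i) {p. i # p \<in> ?g ` S}) (hit ts (?g ` S))
          = map (\<lambda>j. restrict_tree (?us ! j) {p. j # p \<in> S}) (hit ?us S)"
          unfolding h map_map by (intro map_cong refl) (simp only: comp_def)
        \<comment> \<open>Both sides apply the same case distinction to the same list of restricted
          children, so it does not matter whether \<open>S\<close> causes the root to be
          suppressed.\<close>
        then show ?thesis unfolding restrict_Node by (simp only:)
      qed
      ultimately show ?thesis unfolding R by (intro exI[of _ ?g]) blast
    qed
  qed
qed

text \<open>Pruning never adds children, and vertices left with a single child are suppressed, so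
  the bounds 2 and \<open>d\<close> survive.\<close>

lemma rtree_dary_restrict:
  assumes "rtree_dary d t" "U \<noteq> {}" "U \<subseteq> rtree_leaves t"
  shows "rtree_dary d (restrict_tree t U)"
  using assms
proof (induction t arbitrary: U)
  case (Node ts)
  show ?case
  proof (cases "ts = []")
    case True
    then show ?thesis by (simp add: restrict_tree_def)
  next
    case False
    note hit = rtree_leaves_hit[OF Node.prems(2,3) False]
    have IH: "rtree_dary d (restrict_tree (ts ! i) {p. i # p \<in> U})" if "i \<in> set (hit ts U)" for i
      by (rule Node.IH[OF _ _ hit(4)[OF that] hit(3)]) (use that Node.prems(1) in simp_all)
    show ?thesis
    proof (cases "length (hit ts U) = 1")
      case True
      then obtain i where "hit ts U = [i]" by (auto simp: length_Suc_conv)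
      then show ?thesis using IH restrict_Node_single by (metis list.set_intros(1))
    next
      case ne: False
      then have "length (hit ts U) \<ge> 2" using hit(2)
        by (metis One_nat_def length_0_conv less_2_cases not_le)
      moreover have "length (hit ts U) \<le> d"
        using Node.prems(1) False length_filter_le[of _ "[0..<length ts]"]
        by (metis (no_types, lifting) diff_zero le_trans length_upt rtree_dary.simps)
      ultimately show ?thesis using IH by (auto simp: restrict_Node_multi[OF ne])
    qed
  qed
qed

section \<open>Counting leaves and copies\<close>

lemma finite_leaves: "finite (leaves T)"
  by (simp add: leaves_def finite_rtree_leaves split: option.split)

lemma num_leaves_None [simp]: "num_leaves None = 0"
  by (simp add: num_leaves_def leaves_def)

lemma num_leaves_Some: "num_leaves (Some t) = card (rtree_leaves t)"
  by (simp add: num_leaves_def leaves_def)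

lemma num_leaves_Some_pos: "num_leaves (Some t) > 0"
  by (simp add: num_leaves_Some card_gt_0_iff finite_rtree_leaves rtree_leaves_nonempty)

lemma num_leaves_Node:
  "num_leaves (Some (Node ts)) = (if ts = [] then 1 else \<Sum>i<length ts. num_leaves (Some (ts ! i)))"
proof -
  have "card (\<Union>i<length ts. (#) i ` rtree_leaves (ts ! i)) =
      (\<Sum>i<length ts. card ((#) i ` rtree_leaves (ts ! i)))"
    by (rule card_UN_disjoint) (auto simp: finite_rtree_leaves)
  then show ?thesis by (simp add: num_leaves_Some rtree_leaves_Node card_image)
qed

lemma copies_le: "copies D T \<le> num_leaves T choose num_leaves D"
proof -
  have "copies D T \<le> card {S. S \<subseteq> leaves T \<and> card S = num_leaves D}"
    unfolding copies_def by (intro card_mono) (auto simp: finite_leaves)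
  also have "\<dots> = num_leaves T choose num_leaves D"
    by (simp add: n_subsets finite_leaves num_leaves_def)
  finally show ?thesis .
qed

lemma copy_density_nonneg: "copy_density D T \<ge> 0"
  by (simp add: copy_density_def)

text \<open>Taking images under the bijection of \<open>restrict_restrict\<close> preserves induced
  trees. Copies in a restricted tree can thus be counted inside \<open>t\<close>, which makes
  different restrictions of \<open>t\<close> comparable.\<close>

lemma copies_restrict_tree:
  assumes U: "U \<noteq> {}" "U \<subseteq> rtree_leaves t"
  shows "num_leaves (Some (restrict_tree t U)) = card U"
    and "copies (Some D) (Some (restrict_tree t U)) =
      card {S. S \<subseteq> U \<and> card S = num_leaves (Some D) \<and> tree_iso (induced (Some t) S) (Some D)}"
proof -
  let ?L = "rtree_leaves (restrict_tree t U)" and ?k = "num_leaves (Some D)"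
  obtain g where g: "bij_betw g ?L U"
    and gR: "\<And>S. S \<subseteq> ?L \<Longrightarrow> S \<noteq> {} \<Longrightarrow> restrict_tree t (g ` S) = restrict_tree (restrict_tree t U) S"
    using restrict_restrict[OF U] by blast
  show "num_leaves (Some (restrict_tree t U)) = card U"
    using bij_betw_same_card[OF g] by (simp add: num_leaves_Some)
  let ?A = "{S. S \<subseteq> ?L \<and> card S = ?k \<and> tree_iso (induced (Some (restrict_tree t U)) S) (Some D)}"
  let ?B = "{S. S \<subseteq> U \<and> card S = ?k \<and> tree_iso (induced (Some t) S) (Some D)}"
  have card_g: "card (g ` S) = card S" if "S \<subseteq> ?L" for S
    using that g by (meson bij_betw_imp_inj_on card_image inj_on_subset)
  have ind: "induced (Some t) (g ` S) = induced (Some (restrict_tree t U)) S"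
    if S: "S \<subseteq> ?L" "card S = ?k" for S
  \<comment> \<open>The tree \<open>D\<close> has a leaf, so \<open>S\<close> is nonempty, as
    \<open>restrict_restrict\<close> and \<open>induced_Some\<close> require.\<close>
  proof -
    have "S \<noteq> {}" using S(2) num_leaves_Some_pos[of D] by auto
    moreover have "g ` S \<subseteq> rtree_leaves t"
      using S(1) U(2) bij_betw_imp_surj_on[OF g] by blast
    ultimately show ?thesis using S(1) gR by (simp add: induced_Some)
  qed
  have "bij_betw ((`) g) ?A ?B"
  proof (rule bij_betw_imageI)
    show "inj_on ((`) g) ?A"
      using bij_betw_imp_inj_on[OF g] by (intro inj_on_subset[OF inj_on_image_Pow]) auto
    show "(`) g ` ?A = ?B"
    proof (intro equalityI subsetI)
      fix S assume "S \<in> (`) g ` ?A"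
      then obtain S' where S': "S' \<in> ?A" "S = g ` S'" by blast
      moreover have "g ` S' \<subseteq> U" using S'(1) bij_betw_imp_surj_on[OF g] by blast
      ultimately show "S \<in> ?B" using ind card_g by simp
    next
      fix S assume S: "S \<in> ?B"
      then have "S \<subseteq> g ` ?L" using bij_betw_imp_surj_on[OF g] by simp
      then obtain S' where S': "S' \<subseteq> ?L" "S = g ` S'" by (rule subset_imageE)
      then have "S' \<in> ?A" using S ind card_g by auto
      then show "S \<in> (`) g ` ?A" using S' by blast
    qed
  qed
  then show "copies (Some D) (Some (restrict_tree t U)) = card ?B"
    by (simp add: bij_betw_same_card copies_def leaves_def)
qed

section \<open>Monotonicity and convergence of the maximal density\<close>

text \<open>A random leaf is deleted; each copy of \<open>D\<close> survives unless it contains that leaf.\<close>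

lemma ex_copy_density_ge:
  assumes "dary d T" "num_leaves T = Suc n" "num_leaves (Some D) \<le> n"
  shows "\<exists>T'. dary d T' \<and> num_leaves T' = n \<and> copy_density (Some D) T \<le> copy_density (Some D) T'"
proof (rule ccontr)
  assume contra: "\<nexists>T'. dary d T' \<and> num_leaves T' = n \<and> copy_density (Some D) T \<le> copy_density (Some D) T'"
  obtain t where t: "T = Some t" using assms(2) by (cases T) auto
  let ?L = "rtree_leaves t" and ?k = "num_leaves (Some D)"
  let ?G = "{S. S \<subseteq> ?L \<and> card S = ?k \<and> tree_iso (induced (Some t) S) (Some D)}"
  let ?T = "\<lambda>l. Some (restrict_tree t (?L - {l}))"
  have cL: "card ?L = Suc n" using assms(2) by (simp add: t num_leaves_Some)
  have fL: "finite ?L" by (rule finite_rtree_leaves)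
  have fG: "finite ?G" using fL by simp
  have G: "copies (Some D) T = card ?G" by (simp add: copies_def t leaves_def)
  have n: "n > 0" using assms(3) num_leaves_Some_pos[of D] by simp
  have ne: "?L - {l} \<noteq> {}" "?L - {l} \<subseteq> ?L" if "l \<in> ?L" for l
  proof -
    have "card (?L - {l}) = n" using that cL by simp
    then show "?L - {l} \<noteq> {}" using n by force
  qed auto
  \<comment> \<open>By the contrary assumption every deletion lowers the density strictly; clearing
    the denominator gives this bound on the copies.\<close>
  have "real (copies (Some D) (?T l)) < real (copies (Some D) T) * real (n choose ?k) / real (Suc n choose ?k)"
    if "l \<in> ?L" for l
  proof -
    have "dary d (?T l)" "num_leaves (?T l) = n"
      using rtree_dary_restrict[OF _ ne[OF that]] copies_restrict_tree(1)[OF ne[OF that]] assms(1)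
        cL that by (simp_all add: dary_def t)
    then have "copy_density (Some D) (?T l) < copy_density (Some D) T"
      using contra not_le by blast
    then show ?thesis
      using assms(2,3) \<open>num_leaves (?T l) = n\<close>
      by (simp add: copy_density_def field_simps)
  qed
  then have "(\<Sum>l\<in>?L. real (copies (Some D) (?T l))) <
      (\<Sum>l\<in>?L. real (copies (Some D) T) * real (n choose ?k) / real (Suc n choose ?k))"
    by (intro sum_strict_mono fL rtree_leaves_nonempty)
  also have "\<dots> = real (copies (Some D) T) * (real (Suc n * (n choose ?k)) / real (Suc n choose ?k))"
    by (simp only: sum_constant cL of_nat_mult times_divide_eq_right mult_ac)
  \<comment> \<open>Absorption cancels the binomials, so the sum of the bounds over all leaves
    becomes an integer.\<close>
  also have "Suc n * (n choose ?k) = (Suc n - ?k) * (Suc n choose ?k)"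
    using binomial_absorb_comp[of "Suc n" ?k] by simp
  also have "real (copies (Some D) T) * (real \<dots> / real (Suc n choose ?k)) = real ((Suc n - ?k) * copies (Some D) T)"
    using assms(3) by simp
  finally have less: "(\<Sum>l\<in>?L. copies (Some D) (?T l)) < (Suc n - ?k) * copies (Some D) T"
    unfolding of_nat_sum[symmetric] of_nat_less_iff .
  \<comment> \<open>Double counting of pairs of a copy and a leaf outside it: each copy avoids
    exactly \<open>Suc n - ?k\<close> leaves. The sum therefore equals the value it was shown to lie
    strictly below.\<close>
  have "(\<Sum>l\<in>?L. copies (Some D) (?T l)) = (\<Sum>l\<in>?L. card {S\<in>?G. l \<notin> S})"
  proof (rule sum.cong)
    fix l assume "l \<in> ?L"
    show "copies (Some D) (?T l) = card {S\<in>?G. l \<notin> S}"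
      unfolding copies_restrict_tree(2)[OF ne[OF \<open>l \<in> ?L\<close>]]
      by (rule arg_cong[of _ _ card]) auto
  qed simp
  also have "\<dots> = (Suc n - ?k) * card ?G"
  proof (rule sum_multicount[OF fL fG], rule ballI)
    fix S assume "S \<in> ?G"
    then have S: "S \<subseteq> ?L" "card S = ?k" by auto
    have "{l\<in>?L. l \<notin> S} = ?L - S" by auto
    then show "card {l\<in>?L. l \<notin> S} = Suc n - ?k"
      using S cL finite_subset[OF S(1) fL] by (simp add: card_Diff_subset)
  qed
  finally show False using less G by simp
qed

text \<open>Caterpillars suffice: a new root joins one new leaf to the previous tree. This keeps the
  set under \<open>Max\<close> in \<open>max_density\<close> nonempty.\<close>

lemma ex_dary: "d \<ge> 2 \<Longrightarrow> \<exists>T. dary d T \<and> num_leaves T = n"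
proof (induction n)
  case 0
  show ?case by (intro exI[of _ None]) (simp add: dary_def)
next
  case (Suc n)
  then obtain T where T: "dary d T" "num_leaves T = n" by blast
  have leaf: "num_leaves (Some (Node [])) = 1" by (simp add: num_leaves_Node)
  show ?case
  proof (cases T)
    case None
    then show ?thesis using T leaf by (intro exI[of _ "Some (Node [])"]) (simp add: dary_def)
  next
    case (Some t)
    then have "dary d (Some (Node [Node [], t]))" "num_leaves (Some (Node [Node [], t])) = Suc n"
      using T Suc.prems leaf by (simp_all add: dary_def num_leaves_Node[of "[Node [], t]"] numeral_2_eq_2)
    then show ?thesis by blast
  qed
qed

text \<open>The denominator depends only on \<open>n\<close> and the numerator is a bounded natural
  number, so the values are finitely many without any count of the trees.\<close>

lemma finite_copy_densities: "finite {copy_density D T | T. dary d T \<and> num_leaves T = n}"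
proof (rule finite_subset)
  show "{copy_density D T | T. dary d T \<and> num_leaves T = n} \<subseteq>
      (\<lambda>c. real c / real (n choose num_leaves D)) ` {..n choose num_leaves D}"
    using copies_le by (auto simp: copy_density_def)
qed simp

lemma copy_density_le_max_density:
  assumes "dary d T"
  shows "copy_density D T \<le> max_density d D (num_leaves T)"
  unfolding max_density_def using assms by (intro Max_ge finite_copy_densities) auto

lemma max_density_attained:
  assumes "d \<ge> 2"
  obtains T where "dary d T" "num_leaves T = n" "copy_density D T = max_density d D n"
proof -
  have "max_density d D n \<in> {copy_density D T | T. dary d T \<and> num_leaves T = n}"
    unfolding max_density_def using ex_dary[OF assms] by (intro Max_in finite_copy_densities) auto
  then show ?thesis using that by auto
qed

lemma max_density_nonneg: "d \<ge> 2 \<Longrightarrow> max_density d D n \<ge> 0"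
  by (metis max_density_attained copy_density_nonneg)

lemma max_density_Suc_le:
  assumes "d \<ge> 2" "num_leaves (Some D) \<le> n"
  shows "max_density d (Some D) (Suc n) \<le> max_density d (Some D) n"
proof -
  obtain T where T: "dary d T" "num_leaves T = Suc n"
    "copy_density (Some D) T = max_density d (Some D) (Suc n)"
    using max_density_attained[OF assms(1)] .
  obtain T' where T': "dary d T'" "num_leaves T' = n" "copy_density (Some D) T \<le> copy_density (Some D) T'"
    using ex_copy_density_ge[OF T(1,2) assms(2)] by blast
  then show ?thesis using T(3) copy_density_le_max_density[OF T'(1), of "Some D"] by simp
qed

text \<open>A nonincreasing nonnegative sequence converges to a lower bound of its terms, so the
  upper limit is a limit. The lower bound supplies good trees for the branches; the limit allows
  evaluation along a subsequence.\<close>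

lemma max_density_tendsto:
  assumes "d \<ge> 2"
  shows "max_density d (Some D) \<longlonglongrightarrow> inducibility d (Some D)"
    and "num_leaves (Some D) \<le> n \<Longrightarrow> inducibility d (Some D) \<le> max_density d (Some D) n"
proof -
  let ?k = "num_leaves (Some D)" and ?f = "max_density d (Some D)"
  \<comment> \<open>The shift by \<open>?k\<close> is needed because monotonicity is only known from
    \<open>num_leaves (Some D)\<close> on.\<close>
  have "decseq (\<lambda>n. ?f (n + ?k))"
    using assms by (intro decseq_SucI) (simp add: max_density_Suc_le)
  then obtain L where L: "(\<lambda>n. ?f (n + ?k)) \<longlonglongrightarrow> L" "\<And>n. L \<le> ?f (n + ?k)"
    using decseq_convergent[of "\<lambda>n. ?f (n + ?k)" 0] max_density_nonneg[OF assms] by blast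
  have lim: "?f \<longlonglongrightarrow> L" using L(1) by (rule LIMSEQ_offset)
  then have "limsup (\<lambda>n. ereal (?f n)) = ereal L"
    by (intro lim_imp_Limsup) simp_all
  then have I: "inducibility d (Some D) = L" by (simp add: inducibility_def)
  show "?f \<longlonglongrightarrow> inducibility d (Some D)" using lim by (simp add: I)
  show "inducibility d (Some D) \<le> ?f n" if "?k \<le> n"
    using L(2)[of "n - ?k"] that by (simp add: I)
qed

lemma inducibility_nonneg: "d \<ge> 2 \<Longrightarrow> inducibility d D \<ge> 0"
proof (cases D)
  case (Some t)
  assume "d \<ge> 2"
  then show ?thesis
    using LIMSEQ_le_const[OF max_density_tendsto(1), of d 0] max_density_nonneg Some by blast
qed (simp add: inducibility_def)

section \<open>Joining trees under a common root\<close>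

lemma edge_iff:
  assumes "p \<in> vertices t" "q \<in> vertices t"
  shows "{p, q} \<in> edges t \<longleftrightarrow> (\<exists>i. q = p @ [i] \<or> p = q @ [i])"
  using assms by (auto simp: edges_def doubleton_eq_iff)

text \<open>Isomorphisms of the branches act on the part of the address after the first index. They
  fix the branch roots, so the edges at the new root are preserved as well.\<close>

lemma rtree_iso_Node:
  assumes len: "length ds = length es"
    and iso: "\<And>i. i < length ds \<Longrightarrow> rtree_iso (ds ! i) (es ! i)"
  shows "rtree_iso (Node ds) (Node es)"
proof -
  let ?r = "length ds"
  have "\<forall>i\<in>{..<?r}. \<exists>f. bij_betw f (vertices (ds ! i)) (vertices (es ! i)) \<and> f [] = [] \<and>
      (\<forall>p\<in>vertices (ds ! i). \<forall>q\<in>vertices (ds ! i).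
        {p, q} \<in> edges (ds ! i) \<longleftrightarrow> {f p, f q} \<in> edges (es ! i))"
    using iso by (simp add: rtree_iso_def)
  from bchoice[OF this] obtain f where
    f: "\<And>i. i < ?r \<Longrightarrow> bij_betw (f i) (vertices (ds ! i)) (vertices (es ! i))" and
    f0: "\<And>i. i < ?r \<Longrightarrow> f i [] = []" and
    fe: "\<And>i p q. i < ?r \<Longrightarrow> p \<in> vertices (ds ! i) \<Longrightarrow> q \<in> vertices (ds ! i) \<Longrightarrow>
        {p, q} \<in> edges (ds ! i) \<longleftrightarrow> {f i p, f i q} \<in> edges (es ! i)"
    by fast
  have fV: "f i p \<in> vertices (es ! i)" if "i < ?r" "p \<in> vertices (ds ! i)" for i p
    using f[OF that(1)] that(2) by (rule bij_betwE[THEN bspec])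
  \<comment> \<open>Only the root of a branch may go to a root, since otherwise the new root would
    gain an edge.\<close>
  have fNil: "f i p = [] \<longleftrightarrow> p = []" if "i < ?r" "p \<in> vertices (ds ! i)" for i p
    using bij_betw_imp_inj_on[OF f[OF that(1)]] f0[OF that(1)] that(2) Nil_mem_vertices
    by (metis inj_onD)
  define g where "g = (\<lambda>p. case p of [] \<Rightarrow> [] | i # q \<Rightarrow> i # f i q)"
  have [simp]: "g [] = []" "g (i # q) = i # f i q" for i q by (simp_all add: g_def)
  have gV: "g p \<in> vertices (Node es)" if "p \<in> vertices (Node ds)" for p
    using that fV len by (cases p) (auto simp: Cons_mem_vertices_iff)
  have "bij_betw g (vertices (Node ds)) (vertices (Node es))"
  proof (rule bij_betw_imageI)
    show "inj_on g (vertices (Node ds))"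
    proof (rule inj_onI)
      fix p q assume "p \<in> vertices (Node ds)" "q \<in> vertices (Node ds)" "g p = g q"
      then show "p = q"
        using bij_betw_imp_inj_on[OF f, THEN inj_onD]
        by (cases p; cases q) (auto simp: Cons_mem_vertices_iff simp del: vertices.simps)
    qed
    show "g ` vertices (Node ds) = vertices (Node es)"
    proof (intro equalityI subsetI)
      fix p assume p: "p \<in> vertices (Node es)"
      show "p \<in> g ` vertices (Node ds)"
      proof (cases p)
        case Nil
        then show ?thesis by (intro image_eqI[of _ _ "[]"]) simp_all
      next
        case (Cons i q)
        then have i: "i < ?r" "q \<in> vertices (es ! i)"
          using p len by (simp_all add: Cons_mem_vertices_iff del: vertices.simps)
        then obtain q' where "q' \<in> vertices (ds ! i)" "q = f i q'"
          using bij_betw_imp_surj_on[OF f[OF i(1)]] by blast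
        then show ?thesis using i(1) Cons
          by (intro image_eqI[of _ _ "i # q'"]) (simp_all add: Cons_mem_vertices_iff del: vertices.simps)
      qed
    qed (use gV in blast)
  qed
  moreover have "{p, q} \<in> edges (Node ds) \<longleftrightarrow> {g p, g q} \<in> edges (Node es)"
    if p: "p \<in> vertices (Node ds)" and q: "q \<in> vertices (Node ds)" for p q
  proof (cases "p = [] \<or> q = []")
    case True
    then show ?thesis using p q fNil
      unfolding edge_iff[OF p q] edge_iff[OF gV[OF p] gV[OF q]]
      by (cases p; cases q) (auto simp: Cons_mem_vertices_iff simp del: vertices.simps)
  next
    case False
    then obtain i p' j q' where pq: "p = i # p'" "q = j # q'" by (meson list.exhaust)
    then have i: "i < ?r" "p' \<in> vertices (ds ! i)" and j: "j < ?r" "q' \<in> vertices (ds ! j)"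
      using p q by (simp_all add: Cons_mem_vertices_iff del: vertices.simps)
    show ?thesis
    proof (cases "i = j")
      case True
      have q': "q' \<in> vertices (ds ! i)" using j True by simp
      show ?thesis
        using fe[OF i q'] True
        unfolding edge_iff[OF p q] edge_iff[OF gV[OF p] gV[OF q]] edge_iff[OF i(2) q']
          edge_iff[OF fV[OF i] fV[OF i(1) q']]
        by (simp add: pq)
    next
      \<comment> \<open>Vertices in different branches are never adjacent, and \<open>g\<close>
        keeps the branch index.\<close>
      case False
      then show ?thesis
        unfolding edge_iff[OF p q] edge_iff[OF gV[OF p] gV[OF q]] by (simp add: pq)
    qed
  qed
  ultimately show ?thesis unfolding rtree_iso_def by (intro exI[of _ g]) simp
qed

text \<open>Choosing one copy in each branch yields a copy of the whole tree, and the choice can be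
  read off from the union. Other copies may exist, hence only an inequality.\<close>

lemma prod_copies_le_copies_Node:
  assumes len: "length ts = length ds" and ds: "length ds \<ge> 2"
  shows "(\<Prod>i<length ds. copies (Some (ds ! i)) (Some (ts ! i))) \<le>
    copies (Some (Node ds)) (Some (Node ts))"
proof -
  let ?r = "length ds" and ?L = "\<lambda>i. rtree_leaves (ts ! i)"
    and ?k = "\<lambda>i. num_leaves (Some (ds ! i))"
  define G where "G = (\<lambda>i. {S. S \<subseteq> ?L i \<and> card S = ?k i \<and>
    tree_iso (induced (Some (ts ! i)) S) (Some (ds ! i))})"
  let ?G = "{S. S \<subseteq> rtree_leaves (Node ts) \<and> card S = num_leaves (Some (Node ds)) \<and>
    tree_iso (induced (Some (Node ts)) S) (Some (Node ds))}"
  define u where "u = (\<lambda>F :: nat \<Rightarrow> nat list set. \<Union>i<?r. (#) i ` F i)"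
  have uF: "{p. i # p \<in> u F} = F i" if "i < ?r" for i F using that by (auto simp: u_def)
  have u: "u F \<in> ?G" if F: "F \<in> Pi\<^sub>E {..<?r} G" for F
  proof -
    have Fi: "F i \<subseteq> ?L i" "card (F i) = ?k i" "tree_iso (induced (Some (ts ! i)) (F i)) (Some (ds ! i))"
      "finite (F i)" "F i \<noteq> {}" if "i < ?r" for i
    proof -
      have "F i \<in> G i" using F that by auto
      then show i: "F i \<subseteq> ?L i" "card (F i) = ?k i"
        "tree_iso (induced (Some (ts ! i)) (F i)) (Some (ds ! i))" by (auto simp: G_def)
      show "finite (F i)" using i(1) finite_rtree_leaves by (rule finite_subset)
      show "F i \<noteq> {}" using i(2) num_leaves_Some_pos[of "ds ! i"] by auto
    qed
    have sub: "u F \<subseteq> rtree_leaves (Node ts)"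
      by (auto simp: u_def Cons_mem_rtree_leaves_iff len intro: subsetD[OF Fi(1)])
    have "card (u F) = (\<Sum>i<?r. card ((#) i ` F i))"
      unfolding u_def by (rule card_UN_disjoint) (auto simp: Fi(4))
    also have "\<dots> = num_leaves (Some (Node ds))"
      using ds by (auto simp: card_image Fi(2) num_leaves_Node)
    finally have card: "card (u F) = num_leaves (Some (Node ds))" .
    then have ne: "u F \<noteq> {}" using num_leaves_Some_pos[of "Node ds"] by auto
    \<comment> \<open>Every branch is met and there are at least two, so the root is not
      suppressed.\<close>
    have hit: "hit ts (u F) = [0..<?r]"
      using Fi(5) by (auto simp: filter_id_conv len u_def image_iff ex_in_conv)
    have "restrict_tree (Node ts) (u F) =
        Node (map (\<lambda>i. restrict_tree (ts ! i) {p. i # p \<in> u F}) (hit ts (u F)))"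
      by (rule restrict_Node_multi) (use ds in \<open>simp add: hit\<close>)
    also have "\<dots> = Node (map (\<lambda>i. restrict_tree (ts ! i) (F i)) [0..<?r])"
      by (simp add: hit uF)
    finally have res: "restrict_tree (Node ts) (u F) = Node (map (\<lambda>i. restrict_tree (ts ! i) (F i)) [0..<?r])" .
    have "rtree_iso (restrict_tree (ts ! i) (F i)) (ds ! i)" if "i < ?r" for i
      using Fi(3)[OF that] induced_Some[OF Fi(5,1)[OF that]] by (simp add: tree_iso_def)
    then have "rtree_iso (restrict_tree (Node ts) (u F)) (Node ds)"
      unfolding res by (intro rtree_iso_Node) simp_all
    then show ?thesis
      using sub card induced_Some[OF ne sub] by (simp add: tree_iso_def)
  qed
  have "inj_on u (Pi\<^sub>E {..<?r} G)"
  proof (rule inj_onI)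
    fix F F' assume F: "F \<in> Pi\<^sub>E {..<?r} G" "F' \<in> Pi\<^sub>E {..<?r} G" and e: "u F = u F'"
    \<comment> \<open>Inside the index range \<open>uF\<close> recovers the choice from the union;
      outside it extensionality of \<open>Pi\<^sub>E\<close> fixes the value.\<close>
    show "F = F'" by (rule PiE_ext[OF F]) (metis e uF lessThan_iff)
  qed
  then have "card (Pi\<^sub>E {..<?r} G) \<le> card ?G"
    using u by (intro card_inj_on_le[of u]) (auto simp: finite_rtree_leaves)
  then show ?thesis by (simp add: card_PiE copies_def leaves_def G_def)
qed

section \<open>Asymptotics and the lower bound\<close>

text \<open>After division by \<open>m ^ k\<close>, each of the \<open>k\<close> factors
  \<open>m * k - i\<close> of the falling factorial becomes \<open>k - i / m\<close>, which tends to
  \<open>k\<close>.\<close>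

lemma binomial_mult_asymptotics:
  "(\<lambda>m. real ((m * k) choose k) / real m ^ k) \<longlonglongrightarrow> real k ^ k / fact k"
proof -
  have "(\<lambda>m. (\<Prod>i<k. real k - real i / real m) / fact k) \<longlonglongrightarrow> (\<Prod>i<k. real k - 0) / fact k"
    by (intro tendsto_intros lim_const_over_n) simp
  moreover have "eventually (\<lambda>m. (\<Prod>i<k. real k - real i / real m) / fact k =
      real ((m * k) choose k) / real m ^ k) sequentially"
    using eventually_gt_at_top[of 0]
  proof eventually_elim
    case (elim m)
    have "real ((m * k) choose k) = (\<Prod>i<k. real (m * k) - real i) / fact k"
      by (simp add: binomial_gbinomial gbinomial_prod_rev atLeast0LessThan)
    also have "(\<Prod>i<k. real (m * k) - real i) = (\<Prod>i<k. real m * (real k - real i / real m))"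
      using elim by (intro prod.cong) (simp_all add: field_simps)
    also have "\<dots> = real m ^ k * (\<Prod>i<k. real k - real i / real m)"
      by (simp add: prod.distrib)
    finally show ?case using elim by simp
  qed
  ultimately show ?thesis by (simp add: tendsto_cong)
qed

text \<open>The finite form of the bound: near-optimal branches whose leaf numbers are proportional
  to those of the branches of \<open>Node ds\<close> are joined at a root.\<close>

lemma max_density_Node_ge:
  assumes d: "d \<ge> 2" and ds: "2 \<le> length ds" "length ds \<le> d" and m: "m > 0"
  shows "(\<Prod>i<length ds. inducibility d (Some (ds ! i)) *
        real ((m * num_leaves (Some (ds ! i))) choose num_leaves (Some (ds ! i)))) /
      real ((m * num_leaves (Some (Node ds))) choose num_leaves (Some (Node ds)))
    \<le> max_density d (Some (Node ds)) (m * num_leaves (Some (Node ds)))"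
proof -
  let ?r = "length ds" and ?k = "\<lambda>i. num_leaves (Some (ds ! i))"
    and ?I = "\<lambda>i. inducibility d (Some (ds ! i))"
  have "\<exists>t. rtree_dary d t \<and> num_leaves (Some t) = m * ?k i \<and>
      ?I i * real ((m * ?k i) choose ?k i) \<le> real (copies (Some (ds ! i)) (Some t))" for i
  proof -
    obtain T where T: "dary d T" "num_leaves T = m * ?k i"
      "copy_density (Some (ds ! i)) T = max_density d (Some (ds ! i)) (m * ?k i)"
      using max_density_attained[OF d] .
    have k: "?k i > 0" "?k i \<le> m * ?k i" using num_leaves_Some_pos m by simp_all
    \<comment> \<open>The tree \<open>T\<close> has a positive number of leaves, so it is not empty
      and can serve as a child.\<close>
    obtain t where t: "T = Some t" using T(2) k m by (cases T) auto
    have "?I i \<le> real (copies (Some (ds ! i)) T) / real ((m * ?k i) choose ?k i)"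
      using max_density_tendsto(2)[OF d k(2)] T by (simp add: copy_density_def)
    then show ?thesis
      using T k by (intro exI[of _ t]) (simp add: t dary_def pos_le_divide_eq)
  qed
  then obtain t where t: "\<And>i. rtree_dary d (t i)" "\<And>i. num_leaves (Some (t i)) = m * ?k i"
    "\<And>i. ?I i * real ((m * ?k i) choose ?k i) \<le> real (copies (Some (ds ! i)) (Some (t i)))"
    by metis
  let ?ts = "map t [0..<?r]"
  let ?T = "Some (Node ?ts)" and ?D = "Some (Node ds)"
  have dary: "dary d ?T" using ds t(1) by (simp add: dary_def)
  have ne: "ds \<noteq> []" using ds by auto
  then have leaves: "num_leaves ?T = m * num_leaves ?D"
    by (simp add: num_leaves_Node t(2) sum_distrib_left)
  have "(\<Prod>i<?r. ?I i * real ((m * ?k i) choose ?k i)) \<le> (\<Prod>i<?r. real (copies (Some (ds ! i)) (Some (t i))))"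
    using t(3) inducibility_nonneg[OF d] by (intro prod_mono) simp
  also have "\<dots> = real (\<Prod>i<?r. copies (Some (ds ! i)) (Some (?ts ! i)))"
    by simp
  also have "\<dots> \<le> real (copies ?D ?T)"
    using prod_copies_le_copies_Node[of ?ts ds] ds(1) by (intro of_nat_mono) simp
  finally have "(\<Prod>i<?r. ?I i * real ((m * ?k i) choose ?k i)) / real ((m * num_leaves ?D) choose num_leaves ?D)
      \<le> copy_density ?D ?T"
    by (simp add: copy_density_def leaves divide_right_mono)
  also have "\<dots> \<le> max_density d ?D (m * num_leaves ?D)"
    using copy_density_le_max_density[OF dary] by (simp add: leaves)
  finally show ?thesis .
qed

text \<open>The finite bound is passed to the limit along the multiples of \<open>N\<close>.\<close>

lemma inducibility_Node_ge:
  assumes d: "d \<ge> 2" and ds: "2 \<le> length ds" "length ds \<le> d"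
  defines "N \<equiv> num_leaves (Some (Node ds))" and "k \<equiv> (\<lambda>i. num_leaves (Some (ds ! i)))"
  shows "(\<Prod>i<length ds. inducibility d (Some (ds ! i)) * (real (k i) ^ k i / fact (k i))) /
      (real N ^ N / fact N) \<le> inducibility d (Some (Node ds))"
proof (rule LIMSEQ_le)
  let ?r = "length ds" and ?I = "\<lambda>i. inducibility d (Some (ds ! i))"
  \<comment> \<open>Numerator and denominator of the finite bound are both divided by
    \<open>m ^ N\<close>, distributed over the branches as \<open>m ^ k i\<close>; this is possible
    because the \<open>k i\<close> sum to \<open>N\<close>. Each factor then converges.\<close>
  let ?b = "\<lambda>m. (\<Prod>i<?r. ?I i * (real ((m * k i) choose k i) / real m ^ k i)) /
    (real ((m * N) choose N) / real m ^ N)"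
  have N: "N > 0" by (simp add: N_def num_leaves_Some_pos)
  show "?b \<longlonglongrightarrow> (\<Prod>i<?r. ?I i * (real (k i) ^ k i / fact (k i))) / (real N ^ N / fact N)"
    using N by (intro tendsto_intros binomial_mult_asymptotics) simp
  have "strict_mono (\<lambda>m. m * N)" using N by (simp add: strict_mono_def)
  then show "(\<lambda>m. max_density d (Some (Node ds)) (m * N)) \<longlonglongrightarrow> inducibility d (Some (Node ds))"
    using LIMSEQ_subseq_LIMSEQ[OF max_density_tendsto(1)[OF d]] by (simp add: comp_def)
  have "?b m \<le> max_density d (Some (Node ds)) (m * N)" if m: "m \<ge> 1" for m
  proof -
    have "ds \<noteq> []" using ds by auto
    then have Nk: "N = (\<Sum>i<?r. k i)" by (simp add: N_def k_def num_leaves_Node)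
    have "(\<Prod>i<?r. ?I i * (real ((m * k i) choose k i) / real m ^ k i)) =
        (\<Prod>i<?r. ?I i * real ((m * k i) choose k i)) / real m ^ N"
      by (simp add: Nk power_sum prod_dividef[symmetric])
    then have "?b m = (\<Prod>i<?r. ?I i * real ((m * k i) choose k i)) / real ((m * N) choose N)"
      using m by simp
    then show ?thesis
      using max_density_Node_ge[OF d ds, of m] m by (simp add: N_def k_def)
  qed
  then show "\<exists>M. \<forall>m\<ge>M. ?b m \<le> max_density d (Some (Node ds)) (m * N)" by blast
qed

theorem theorem12:
  fixes d :: nat and D :: tree and Ds :: "tree list"
  assumes "d \<ge> 2"
    and "dary d D"
    and "num_leaves D \<ge> 2"
    and "Ds = branches d D"
  shows "inducibility d D \<ge>
    multinomial (num_leaves D) (map num_leaves Ds)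
    * real (num_leaves D) powi (- int (num_leaves D))
    * (\<Prod>i<d. real (num_leaves (Ds ! i)) ^ num_leaves (Ds ! i))
    * (\<Prod>i<d. inducibility d (Ds ! i))"
proof -
  obtain ds where D: "D = Some (Node ds)"
    using assms(3) by (metis num_leaves_None not_numeral_le_zero not_None_eq rtree.exhaust)
  \<comment> \<open>Two leaves exclude the one-vertex tree, so the root is internal and has between
    2 and \<open>d\<close> children.\<close>
  have ds: "2 \<le> length ds" "length ds \<le> d"
    using assms(2,3) by (auto simp: D dary_def num_leaves_Node split: if_splits)
  have Ds: "Ds = map Some ds @ replicate (d - length ds) None"
    by (simp add: assms(4) branches_def D)
  let ?r = "length ds" and ?k = "\<lambda>i. num_leaves (Some (ds ! i))" and ?N = "num_leaves D"
  let ?I = "\<lambda>i. inducibility d (Some (ds ! i))"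
  \<comment> \<open>Empty branches contribute the factor 1 to every product:
    \<open>fact 0 = 1\<close>, \<open>0 ^ 0 = 1\<close>, and the inducibility of \<open>None\<close>
    is 1.\<close>
  have pad: "(\<Prod>i<d. h (Ds ! i)) = (\<Prod>i<?r. h (Some (ds ! i)))" if "h None = 1" for h :: "tree \<Rightarrow> real"
  proof -
    have "(\<Prod>i<d. h (Ds ! i)) = (\<Prod>i<?r. h (Ds ! i))"
      using ds(2) that by (intro prod.mono_neutral_right) (auto simp: Ds nth_append)
    then show ?thesis by (simp add: Ds nth_append)
  qed
  have "length Ds = d" using ds by (simp add: Ds)
  then have "multinomial ?N (map num_leaves Ds) = fact ?N / (\<Prod>i<d. fact (num_leaves (Ds ! i)))"
    by (simp add: multinomial_def prod.list_conv_set_nth atLeast0LessThan)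
  also have "(\<Prod>i<d. fact (num_leaves (Ds ! i)) :: real) = (\<Prod>i<?r. fact (?k i))"
    by (rule pad) simp
  finally have mult: "multinomial ?N (map num_leaves Ds) = fact ?N / (\<Prod>i<?r. fact (?k i))" .
  have "multinomial ?N (map num_leaves Ds) * real ?N powi (- int ?N)
      * (\<Prod>i<d. real (num_leaves (Ds ! i)) ^ num_leaves (Ds ! i)) * (\<Prod>i<d. inducibility d (Ds ! i))
    = fact ?N / (\<Prod>i<?r. fact (?k i)) * real ?N powi (- int ?N)
      * (\<Prod>i<?r. real (?k i) ^ ?k i) * (\<Prod>i<?r. ?I i)"
    using pad[of "\<lambda>T. real (num_leaves T) ^ num_leaves T"] pad[of "inducibility d"]
    by (simp add: mult inducibility_def[of d None])
  also have "\<dots> = (\<Prod>i<?r. ?I i * (real (?k i) ^ ?k i / fact (?k i))) / (real ?N ^ ?N / fact ?N)"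
    by (simp add: power_int_minus prod.distrib prod_dividef field_simps)
  also have "\<dots> \<le> inducibility d D"
    using inducibility_Node_ge[OF assms(1) ds] by (simp add: D)
  finally show ?thesis .
qed

end
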